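(* For each prime power $q$, $\mu(q^2+q+1)=f(q^2+q+1)=q$, where $f(n)=\left\lceil \frac{1}{2}\left(\sqrt{4n-3}-1\right)\right\rceil$ and $\mu(n)$ is the $n$th mediation number.
   Context: Digraphs are finite, without loops or parallel arcs (both arcs $xy$ and $yx$ may be present). For a digraph $D$ and a vertex $x$, let $N^-(x)=\{y: yx\in A(D)\}$ and $N^-[x]=\{x\}\cup N^-(x)$; $\Delta^-(D)$ is the maximum of $|N^-(x)|$ over vertices $x$. A digraph $D$ is mediated if for every pair $x,y$ of distinct vertices there is a vertex $z$ (possibly $z=x$ or $z=y$) such that $x,y\in N^-[z]$. For $n\ge 1$, the $n$th mediation number $\mu(n)$ is the minimum of $\Delta^-(D)$ over all mediated digraphs $D$ on $n$ vertices. A prime power is an integer $p^k$ with $p$ prime and $k\ge 1$. *)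

theory Defs
  imports
    Complex_Main
    "HOL-Number_Theory.Prime_Powers"
    "Graph_Theory.Pair_Digraph"
begin

text \<open>
  The digraphs are those of the locale \<open>pair_digraph\<close>: finite, loopless, and, as arcs are
  ordered pairs of vertices, without parallel arcs. The pair \<open>(y, x)\<close> is the arc from \<open>y\<close> to \<open>x\<close>.
\<close>

definition in_nbrs :: "'a pair_pre_digraph \<Rightarrow> 'a \<Rightarrow> 'a set" where
  "in_nbrs D x = {y. (y, x) \<in> parcs D}"

definition closed_in_nbrs :: "'a pair_pre_digraph \<Rightarrow> 'a \<Rightarrow> 'a set" where
  "closed_in_nbrs D x = insert x (in_nbrs D x)"

definition max_in_degree :: "'a pair_pre_digraph \<Rightarrow> nat" where
  "max_in_degree D = Max ((\<lambda>x. card (in_nbrs D x)) ` pverts D)"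

definition mediated :: "'a pair_pre_digraph \<Rightarrow> bool" where
  "mediated D \<longleftrightarrow>
     (\<forall>x\<in>pverts D. \<forall>y\<in>pverts D. x \<noteq> y \<longrightarrow>
        (\<exists>z\<in>pverts D. x \<in> closed_in_nbrs D z \<and> y \<in> closed_in_nbrs D z))"

text \<open>
  Vertices are taken to be natural numbers; the lemma \<open>mediation_number_le\<close> below shows
  that this choice does not affect the minimum. The value at \<open>n = 0\<close> has no meaning, since
  \<open>max_in_degree\<close> is then the maximum of the empty set.
\<close>

definition mediation_number :: "nat \<Rightarrow> nat" where
  "mediation_number n =
     (LEAST d. \<exists>D :: nat pair_pre_digraph.
        pair_digraph D \<and> card (pverts D) = n \<and> mediated D \<and> max_in_degree D = d)"

definition mediation_bound :: "nat \<Rightarrow> int" where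
  "mediation_bound n = \<lceil>1/2 * (sqrt (4 * real n - 3) - 1)\<rceil>"

lemma mediation_number_attained:
  "\<exists>D :: nat pair_pre_digraph. pair_digraph D \<and> card (pverts D) = n \<and> mediated D \<and>
     max_in_degree D = mediation_number n"
proof -
  define K where "K = \<lparr>pverts = {..<n}, parcs = {(x, y). x < n \<and> y < n \<and> x \<noteq> y}\<rparr>"
  have "finite (parcs K)"
    by (rule finite_subset[of _ "{..<n} \<times> {..<n}"]) (auto simp: K_def)
  then have "pair_digraph K"
    by unfold_locales (auto simp: K_def)
  moreover have "card (pverts K) = n"
    by (simp add: K_def)
  moreover have "mediated K"
    by (auto simp: mediated_def closed_in_nbrs_def in_nbrs_def K_def)
  ultimately show ?thesis
    unfolding mediation_number_def by - (rule LeastI_ex, metis)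
qed

lemma mediation_number_le:
  fixes D :: "'a pair_pre_digraph"
  assumes D: "pair_digraph D" and "mediated D"
  shows "mediation_number (card (pverts D)) \<le> max_in_degree D"
proof -
  interpret pair_digraph D by (fact D)
  obtain h :: "'a \<Rightarrow> nat" where h: "inj_on h (pverts D)"
    using finite_imp_inj_to_nat_seg[OF pair_finite_verts] by blast
  define E where "E = \<lparr>pverts = h ` pverts D, parcs = map_prod h h ` parcs D\<rparr>"
  have nbrs: "in_nbrs E (h x) = h ` in_nbrs D x" if "x \<in> pverts D" for x
  proof (intro equalityI subsetI)
    fix y' assume "y' \<in> in_nbrs E (h x)"
    then obtain u v where uv: "(u, v) \<in> parcs D" "y' = h u" "h x = h v"
      by (auto simp: in_nbrs_def E_def)
    then have "x = v"
      using inj_onD[OF h uv(3)] that in_arcsD2 by blast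
    with uv show "y' \<in> h ` in_nbrs D x"
      by (auto simp: in_nbrs_def)
  next
    fix y' assume "y' \<in> h ` in_nbrs D x"
    then obtain y where "(y, x) \<in> parcs D" "y' = h y"
      by (auto simp: in_nbrs_def)
    then show "y' \<in> in_nbrs E (h x)"
      by (force simp: in_nbrs_def E_def)
  qed
  have "pair_digraph E"
  proof unfold_locales
    show "fst e \<noteq> snd e" if "e \<in> parcs E" for e
    proof -
      from that obtain u v where uv: "(u, v) \<in> parcs D" "e = (h u, h v)"
        by (auto simp: E_def)
      then have "u \<noteq> v" "u \<in> pverts D" "v \<in> pverts D"
        using no_loops' in_arcsD1 in_arcsD2 by blast+
      then show ?thesis
        using uv(2) inj_onD[OF h, of u v] by auto
    qed
  qed (use pair_finite_verts pair_finite_arcs in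
        \<open>auto simp: E_def dest: arc_fst_in_verts arc_snd_in_verts\<close>)
  moreover have "card (pverts E) = card (pverts D)"
    using h by (simp add: E_def card_image)
  moreover have "mediated E"
    unfolding mediated_def
  proof (intro ballI impI)
    fix x' y' assume "x' \<in> pverts E" "y' \<in> pverts E" "x' \<noteq> y'"
    then obtain x y where xy: "x' = h x" "y' = h y" "x \<in> pverts D" "y \<in> pverts D" "x \<noteq> y"
      by (auto simp: E_def)
    then obtain z where z: "z \<in> pverts D" "x \<in> closed_in_nbrs D z" "y \<in> closed_in_nbrs D z"
      using \<open>mediated D\<close> by (auto simp: mediated_def)
    have "x' \<in> closed_in_nbrs E (h z)" "y' \<in> closed_in_nbrs E (h z)"
      using z xy nbrs[OF z(1)] by (auto simp: closed_in_nbrs_def)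
    with z(1) show "\<exists>z\<in>pverts E. x' \<in> closed_in_nbrs E z \<and> y' \<in> closed_in_nbrs E z"
      by (auto simp: E_def)
  qed
  moreover have "max_in_degree E = max_in_degree D"
  proof -
    have "card (in_nbrs E (h x)) = card (in_nbrs D x)" if "x \<in> pverts D" for x
    proof -
      have "in_nbrs D x \<subseteq> pverts D" using in_arcsD1 by (auto simp: in_nbrs_def)
      then show ?thesis unfolding nbrs[OF that] by (intro card_image inj_on_subset[OF h])
    qed
    then have "(\<lambda>x. card (in_nbrs E x)) ` pverts E = (\<lambda>x. card (in_nbrs D x)) ` pverts D"
      by (simp add: E_def image_image cong: image_cong)
    then show ?thesis by (simp add: max_in_degree_def)
  qed
  ultimately show ?thesis
    unfolding mediation_number_def by - (rule Least_le, metis)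
qed

end

theory Submission
  imports
    Defs
    "HOL-Algebra.Algebraic_Closure"
    "HOL-Number_Theory.Residues"
begin

text \<open>
  Counting the pairs of distinct vertices inside the sets \<open>N\<^sup>-[z]\<close> gives
  \<open>n - 1 \<le> \<Delta>\<^sup>-(D) (\<Delta>\<^sup>-(D) + 1)\<close>, hence \<open>\<mu>(q\<^sup>2 + q + 1) \<ge> q\<close>. For equality, take the points of
  the projective plane over a field with \<open>q\<close> elements as vertices and let the sets \<open>N\<^sup>-[z]\<close> be its
  lines, which needs a bijection sending every point to a line through it. The field is
  the set of roots of \<open>X\<^sup>q - X\<close> in an algebraic closure of the field with \<open>p\<close> elements, where \<open>q\<close>
  is a power of the prime \<open>p\<close>.
\<close>

hide_const (open) Divisibility.prime

section \<open>Finite fields\<close>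

lemma (in cring) binomial_theorem:
  assumes "x \<in> carrier R" "y \<in> carrier R"
  shows "(x \<oplus> y) [^] n = (\<Oplus>k\<in>{..n}. [(n choose k)] \<cdot> (x [^] k \<otimes> y [^] (n - k)))"
proof (induction n)
  case 0
  show ?case using assms by simp
next
  case (Suc n)
  \<comment> \<open>\<open>f\<close> is the summand for \<open>n\<close> and \<open>h\<close> the
    one for \<open>Suc n\<close>; \<open>g\<close> has the coefficient of \<open>f\<close> and the
    exponents of \<open>h\<close>. Pascal's rule becomes
    \<open>f k \<otimes> x \<oplus> g (Suc k) = h (Suc k)\<close>.\<close>
  define f where "f k = [(n choose k)] \<cdot> (x [^] k \<otimes> y [^] (n - k))" for k
  define g where "g k = [(n choose k)] \<cdot> (x [^] k \<otimes> y [^] (Suc n - k))" for k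
  define h where "h k = [(Suc n choose k)] \<cdot> (x [^] k \<otimes> y [^] (Suc n - k))" for k
  have [simp]: "f k \<in> carrier R" "g k \<in> carrier R" "h k \<in> carrier R" for k
    using assms by (simp_all add: f_def g_def h_def)
  have x: "f k \<otimes> x \<oplus> g (Suc k) = h (Suc k)" for k
  proof -
    have "f k \<otimes> x = [(n choose k)] \<cdot> (x [^] Suc k \<otimes> y [^] (n - k))"
    proof -
      have "x [^] k \<otimes> y [^] (n - k) \<otimes> x = x [^] Suc k \<otimes> y [^] (n - k)"
        using assms by (simp add: m_ac)
      with assms show ?thesis by (simp add: f_def add_pow_ldistr)
    qed
    then show ?thesis
      using assms by (simp add: g_def h_def add.nat_pow_mult)
  qed
  have y: "f k \<otimes> y = g k" if "k \<le> n" for k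
    using assms that by (simp add: f_def g_def add_pow_ldistr m_assoc Suc_diff_le)
  have "g (Suc n) = \<zero>"
    using assms by (simp add: g_def binomial_eq_0)
  have "(x \<oplus> y) [^] Suc n = (\<Oplus>k\<in>{..n}. f k \<otimes> x) \<oplus> (\<Oplus>k\<in>{..n}. f k \<otimes> y)"
    using assms Suc.IH by (simp add: r_distr finsum_ldistr flip: f_def)
  also have "(\<Oplus>k\<in>{..n}. f k \<otimes> y) = (\<Oplus>k\<in>{..n}. g k)"
    by (rule finsum_cong') (auto simp: y)
  also have "\<dots> = (\<Oplus>k\<in>{..Suc n}. g k)"
    using \<open>g (Suc n) = \<zero>\<close> finsum_Suc[of g n] by simp
  also have "\<dots> = (\<Oplus>k\<in>{..n}. g (Suc k)) \<oplus> g 0"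
    by (rule finsum_Suc2) simp
  also have "(\<Oplus>k\<in>{..n}. f k \<otimes> x) \<oplus> \<dots> = (\<Oplus>k\<in>{..n}. f k \<otimes> x \<oplus> g (Suc k)) \<oplus> g 0"
    using assms by (subst finsum_addf) (simp_all add: a_assoc)
  also have "\<dots> = (\<Oplus>k\<in>{..n}. h (Suc k)) \<oplus> h 0"
    by (simp only: x) (simp add: g_def h_def)
  also have "\<dots> = (\<Oplus>k\<in>{..Suc n}. h k)"
    by (rule finsum_Suc2[symmetric]) simp
  finally show ?case by (simp add: h_def)
qed

text \<open>\<open>p\<close> divides every inner binomial coefficient, which gives the
  \<open>p\<close>-th power; induction on \<open>k\<close> iterates it. Commutative rings are the
  right generality because both a field and its polynomial ring are instances below.\<close>

lemma (in cring) prime_char_add_pow: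
  fixes p k :: nat
  assumes p: "prime p" and char: "[p] \<cdot> \<one> = \<zero>" and xy: "x \<in> carrier R" "y \<in> carrier R"
  shows "(x \<oplus> y) [^] (p ^ k) = x [^] (p ^ k) \<oplus> y [^] (p ^ k)"
proof -
  have mult_zero: "[n] \<cdot> z = \<zero>" if "p dvd n" "z \<in> carrier R" for n :: nat and z
  proof -
    from that obtain m where "n = p * m" by blast
    moreover have "[p] \<cdot> z = \<zero>"
      using add_pow_ldistr[of \<one> z p] that char by simp
    ultimately show ?thesis
      using that by (simp add: add.nat_pow_pow[symmetric])
  qed
  have frobenius: "(x \<oplus> y) [^] p = x [^] p \<oplus> y [^] p"
    if xy: "x \<in> carrier R" "y \<in> carrier R" for x y
  proof -
    define f where "f k = [(p choose k)] \<cdot> (x [^] k \<otimes> y [^] (p - k))" for k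
    have [simp]: "f k \<in> carrier R" for k
      using xy by (simp add: f_def)
    \<comment> \<open>Writing \<open>p\<close> as \<open>Suc (Suc l)\<close> separates the end
      terms, at 0 and \<open>p\<close>, from the inner ones, at \<open>Suc k\<close> with
      \<open>k \<le> l\<close>.\<close>
    obtain m where m: "p = Suc m"
      using p by (meson prime_gt_0_nat gr0_conv_Suc)
    have "m > 0" using prime_gt_1_nat[OF p] m by simp
    then obtain l where l: "m = Suc l"
      using gr0_conv_Suc by blast
    have "f (Suc k) = \<zero>" if "k \<le> l" for k
      unfolding f_def using xy that m l p
      by (intro mult_zero dvd_choose_prime) auto
    then have "(\<Oplus>k\<in>{..l}. f (Suc k)) = (\<Oplus>k\<in>{..l}. \<zero>)"
      by (intro finsum_cong') auto
    then have "(\<Oplus>k\<in>{..p}. f k) = f p \<oplus> f 0"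
      using finsum_Suc[of f m] finsum_Suc2[of f l] by (simp add: m l)
    then show ?thesis
      using xy binomial_theorem[OF xy, of p] by (simp add: f_def)
  qed
  show ?thesis
  proof (induction k)
    case 0
    then show ?case using xy by simp
  next
    case (Suc k)
    have "(x \<oplus> y) [^] (p ^ Suc k) = ((x \<oplus> y) [^] (p ^ k)) [^] p"
      using xy by (simp add: nat_pow_pow mult.commute)
    also have "\<dots> = (x [^] (p ^ k) \<oplus> y [^] (p ^ k)) [^] p"
      by (simp only: Suc)
    also have "\<dots> = x [^] (p ^ Suc k) \<oplus> y [^] (p ^ Suc k)"
      using xy by (simp add: frobenius nat_pow_pow mult.commute)
    finally show ?case .
  qed
qed

section \<open>Fixed points of powers of the Frobenius map\<close>

lemma (in field) subfield_pow_fixed: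
  fixes p k :: nat
  assumes p: "prime p" and char: "[p] \<cdot> \<one> = \<zero>"
  shows "subfield {x \<in> carrier R. x [^] (p ^ k) = x} R" (is "subfield ?K R")
proof (rule subfieldI', rule subringI)
  have pos: "p ^ k > 0" using p by (simp add: prime_gt_0_nat)
  show "\<ominus> h \<in> ?K" if "h \<in> ?K" for h
  proof -
    \<comment> \<open>Additivity on \<open>\<ominus> h \<oplus> h\<close> handles negation without
      splitting on the parity of \<open>p\<close>.\<close>
    have "(\<ominus> h \<oplus> h) [^] (p ^ k) = (\<ominus> h) [^] (p ^ k) \<oplus> h [^] (p ^ k)"
      using that by (intro prime_char_add_pow p char) auto
    with that pos have "(\<ominus> h) [^] (p ^ k) \<oplus> h = \<zero>"
      by (simp add: l_neg nat_pow_zero)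
    with that have "(\<ominus> h) [^] (p ^ k) = \<ominus> h"
      by (intro sum_zero_eq_neg) auto
    with that show ?thesis by simp
  qed
  show "h \<otimes> h' \<in> ?K" if "h \<in> ?K" "h' \<in> ?K" for h h'
    using that by (simp add: nat_pow_distrib)
  show "h \<oplus> h' \<in> ?K" if "h \<in> ?K" "h' \<in> ?K" for h h'
    using that by (simp add: prime_char_add_pow p char)
  show "inv h \<in> ?K" if "h \<in> ?K - {\<zero>}" for h
  proof -
    have h: "h \<in> Units R" "h [^] (p ^ k) = h" using that field_Units by auto
    then have "h [^] (p ^ k) \<otimes> inv h [^] (p ^ k) = (h \<otimes> inv h) [^] (p ^ k)"
      by (intro nat_pow_distrib[symmetric]) auto
    with h have "inv h = inv h [^] (p ^ k)"
      by (intro comm_inv_char) auto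
    with h show ?thesis by simp
  qed
qed auto

text \<open>With \<open>q = p ^ k\<close>, the polynomial \<open>X^q - X\<close> has
  \<open>q\<close> roots counted with multiplicity. Each root \<open>x\<close> is simple, since
  \<open>X^q - X = (X - x)^q - (X - x)\<close> by additivity of \<open>q\<close>-th powers in the
  polynomial ring.\<close>

lemma (in algebraically_closed) card_pow_fixed:
  fixes p k :: nat
  assumes p: "prime p" and char: "[p] \<cdot> \<one> = \<zero>" and "k > 0"
  shows "card {x \<in> carrier L. x [^] (p ^ k) = x} = p ^ k"
proof -
  define P where "P = poly_ring L"
  define q where "q = p ^ k"
  have "q > 1" using prime_gt_1_nat[OF p] \<open>k > 0\<close> unfolding q_def by (intro one_less_power)
  interpret P: domain P
    unfolding P_def by (rule univ_poly_is_domain[OF carrier_is_subring])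
  interpret const: ring_hom_ring L P poly_of_const
    unfolding P_def using canonical_embedding_ring_hom[OF carrier_is_subring] by simp
  have X: "X \<in> carrier P"
    unfolding P_def by (rule var_closed(1)[OF carrier_is_subring])
  \<comment> \<open>The embedding of constants carries the relation \<open>p * 1 = 0\<close> into
    the polynomial ring.\<close>
  have charP: "add_pow P p \<one>\<^bsub>P\<^esub> = \<zero>\<^bsub>P\<^esub>"
  proof -
    have "poly_of_const ([n] \<cdot> \<one>) = add_pow P n \<one>\<^bsub>P\<^esub>" for n :: nat
      by (induction n) simp_all
    from this[of p] char show ?thesis by simp
  qed
  define f where "f = X [^]\<^bsub>P\<^esub> q \<ominus>\<^bsub>P\<^esub> X"
  have f: "f \<in> carrier P"
    using X by (simp add: f_def)
  have degX: "degree (X [^]\<^bsub>P\<^esub> q) = q"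
    using polynomial_pow_degree[OF X[unfolded P_def], of q] by (simp add: P_def var_def)
  have "degree (\<ominus>\<^bsub>P\<^esub> X) = 1"
    using univ_poly_a_inv_degree[OF carrier_is_subring X[unfolded P_def]] by (simp add: P_def var_def)
  \<comment> \<open>As \<open>q > 1\<close>, the two summands differ in degree and the leading term
    survives.\<close>
  have "degree f = q"
  proof -
    have "degree (poly_add (X [^]\<^bsub>P\<^esub> q) (\<ominus>\<^bsub>P\<^esub> X)) = max q 1"
      using X degX \<open>degree (\<ominus>\<^bsub>P\<^esub> X) = 1\<close> \<open>q > 1\<close> poly_add_degree_eq[OF carrier_is_subring]
      by (metis P.a_inv_closed P.nat_pow_closed P_def nat_neq_iff univ_poly_carrier)
    then show ?thesis
      using \<open>q > 1\<close> by (simp add: f_def a_minus_def P_def univ_poly_add)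
  qed
  then have "f \<noteq> []" using \<open>q > 1\<close> by auto
  have eval_f: "eval f x = x [^] q \<ominus> x" if "x \<in> carrier L" for x
  proof -
    interpret ev: ring_hom_ring P L "\<lambda>p. eval p x"
      unfolding P_def by (rule eval_ring_hom[OF carrier_is_subring that])
    show ?thesis
      using that X eval_var[OF that] by (simp add: f_def a_minus_def ev.hom_nat_pow)
  qed
  have root: "is_root f x \<longleftrightarrow> x \<in> carrier L \<and> x [^] q = x" for x
    using \<open>f \<noteq> []\<close> eval_f by (auto simp: is_root_def)
  have simple: "alg_mult f x = 1" if "is_root f x" for x
  proof -
    have x: "x \<in> carrier L" "x [^] q = x" using that root by auto
    define c where "c = poly_of_const x"
    have c: "c \<in> carrier P" using x by (simp add: c_def)
    have "c [^]\<^bsub>P\<^esub> q = c"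
      using x by (simp add: c_def flip: const.hom_nat_pow)
    \<comment> \<open>Coefficient lists start with the leading coefficient, so \<open>l\<close> is
      \<open>X - x\<close>.\<close>
    define l where "l = [\<one>, \<ominus> x]"
    have l: "l \<in> carrier P"
      using x(1) by (simp add: l_def P_def univ_poly_def polynomial_def)
    have X_eq: "X = l \<oplus>\<^bsub>P\<^esub> c"
      using x(1) by (simp add: l_def c_def P_def univ_poly_add poly_of_const_def var_def l_neg)
    have "X [^]\<^bsub>P\<^esub> q = l [^]\<^bsub>P\<^esub> q \<oplus>\<^bsub>P\<^esub> c"
      using P.prime_char_add_pow[OF p charP l c, of k] X_eq \<open>c [^]\<^bsub>P\<^esub> q = c\<close> by (simp add: q_def)
    then have "f = (l [^]\<^bsub>P\<^esub> q \<oplus>\<^bsub>P\<^esub> c) \<ominus>\<^bsub>P\<^esub> (l \<oplus>\<^bsub>P\<^esub> c)"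
      unfolding f_def by (simp only: flip: X_eq)
    also have "\<dots> = l [^]\<^bsub>P\<^esub> q \<ominus>\<^bsub>P\<^esub> l"
      using c l P.nat_pow_closed[OF l, of q] by algebra
    finally have f_eq: "f = l [^]\<^bsub>P\<^esub> q \<ominus>\<^bsub>P\<^esub> l" .
    \<comment> \<open>\<open>l\<^sup>2\<close> divides \<open>l\<^sup>q\<close>, so if it divided \<open>f = l\<^sup>q - l\<close> it would divide \<open>l\<close>\<close>
    have "\<not> l [^]\<^bsub>P\<^esub> (2::nat) pdivides f"
    proof
      assume "l [^]\<^bsub>P\<^esub> (2::nat) pdivides f"
      moreover have "l [^]\<^bsub>P\<^esub> (2::nat) pdivides l [^]\<^bsub>P\<^esub> q"
        using polynomial_pow_division[of l 2 q] l \<open>q > 1\<close> by (simp add: P_def)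
      ultimately obtain u v where uv: "u \<in> carrier P" "f = l [^]\<^bsub>P\<^esub> (2::nat) \<otimes>\<^bsub>P\<^esub> u"
        "v \<in> carrier P" "l [^]\<^bsub>P\<^esub> q = l [^]\<^bsub>P\<^esub> (2::nat) \<otimes>\<^bsub>P\<^esub> v"
        unfolding pdivides_def P_def[symmetric] by (blast elim: dividesE)
      have "l = l [^]\<^bsub>P\<^esub> q \<ominus>\<^bsub>P\<^esub> f"
        using l P.nat_pow_closed[OF l, of q] unfolding f_eq by algebra
      also have "\<dots> = l [^]\<^bsub>P\<^esub> (2::nat) \<otimes>\<^bsub>P\<^esub> (v \<ominus>\<^bsub>P\<^esub> u)"
        using l P.nat_pow_closed[OF l, of 2] uv(1,3) unfolding uv(2,4) by algebra
      finally have "l [^]\<^bsub>P\<^esub> (2::nat) pdivides l"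
        unfolding pdivides_def P_def[symmetric] using uv by (intro dividesI[of "v \<ominus>\<^bsub>P\<^esub> u"]) auto
      moreover have "degree l = 1" "l \<noteq> []" by (simp_all add: l_def)
      ultimately show False
        using pdivides_imp_degree_le[OF carrier_is_subring, of "l [^]\<^bsub>P\<^esub> (2::nat)" l] l P.nat_pow_closed[OF l, of 2]
          polynomial_pow_degree[of l 2] by (simp add: P_def)
    qed
    moreover have "l [^]\<^bsub>P\<^esub> (2::nat) pdivides f" if "2 \<le> alg_mult f x"
      using le_alg_mult_imp_pdivides[OF x(1) f[unfolded P_def] that] by (simp add: P_def l_def)
    moreover have "alg_mult f x > 0"
      using alg_mult_gt_zero_iff_is_root[OF f[unfolded P_def]] \<open>is_root f x\<close> by simp
    ultimately show ?thesis by linarith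
  qed
  have roots: "set_mset (roots f) = {x. is_root f x}"
    using roots_mem_iff_is_root[OF f[unfolded P_def]] by blast
  have "q = size (roots f)"
    using roots_over_carrier[OF f[unfolded P_def]] \<open>degree f = q\<close> by (simp add: splitted_def)
  also have "\<dots> = (\<Sum>x\<in>{x. is_root f x}. alg_mult f x)"
    unfolding size_multiset_overloaded_eq roots alg_mult_eq_count_roots[OF f[unfolded P_def]] ..
  also have "\<dots> = card {x. is_root f x}"
    using simple by simp
  finally show ?thesis
    by (simp add: root q_def)
qed

text \<open>The element type is that of the algebraic closure of a residue ring over the integers,
  inside which the field is cut out.\<close>

lemma finite_field_exists:
  assumes "primepow q"
  shows "\<exists>F :: (((int list \<times> nat) multiset) \<Rightarrow> int) ring. field F \<and> card (carrier F) = q"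
proof -
  from assms obtain p k where p: "prime p" and "k > 0" and q: "q = p ^ k"
    by (auto simp: primepow_def)
  define R where "R = residue_ring (int p)"
  interpret R: residues_prime p R
    using p by unfold_locales (simp_all add: R_def)
  interpret R: field R by (rule R.is_field)
  interpret L: algebraic_closure R.alg_closure "R.indexed_const ` carrier R"
    by (rule R.alg_closureE)
  interpret hom: ring_hom_ring R R.alg_closure R.indexed_const
    using R.alg_closureE(2) by unfold_locales
  have "[n] \<cdot>\<^bsub>R.alg_closure\<^esub> \<one>\<^bsub>R.alg_closure\<^esub> = R.indexed_const ([n] \<cdot>\<^bsub>R\<^esub> \<one>\<^bsub>R\<^esub>)" for n :: nat
    by (induction n) simp_all
  moreover have "[p] \<cdot>\<^bsub>R\<^esub> \<one>\<^bsub>R\<^esub> = \<zero>\<^bsub>R\<^esub>"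
  proof -
    \<comment> \<open>The additive group has order \<open>p\<close>, so Lagrange's theorem gives
      \<open>p * 1 = 0\<close>.\<close>
    have "order (add_monoid R) = p"
      by (simp add: order_def R.res_carrier_eq)
    then show ?thesis
      using R.add.pow_order_eq_1[of "\<one>\<^bsub>R\<^esub>"] by simp
  qed
  ultimately have char: "[p] \<cdot>\<^bsub>R.alg_closure\<^esub> \<one>\<^bsub>R.alg_closure\<^esub> = \<zero>\<^bsub>R.alg_closure\<^esub>"
    by simp
  show ?thesis
    using L.subfield_iff(2)[OF L.subfield_pow_fixed[OF p char, of k]]
      L.card_pow_fixed[OF p char \<open>k > 0\<close>] q by fastforce
qed

section \<open>Mediated digraphs\<close>

lemma card_in_nbrs_le_max_in_degree:
  assumes "pair_digraph D" "x \<in> pverts D"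
  shows "card (in_nbrs D x) \<le> max_in_degree D"
proof -
  interpret pair_digraph D by (fact assms)
  show ?thesis
    using assms(2) pair_finite_verts unfolding max_in_degree_def by (intro Max_ge) auto
qed

text \<open>With \<open>n\<close> vertices and maximum in-degree \<open>d\<close>, the
  \<open>n\<close> closed in-neighbourhoods cover at most \<open>(d + 1) * d\<close> ordered pairs
  each, and \<open>n * (n - 1)\<close> pairs must be covered; cancelling \<open>n\<close> gives the
  bound.\<close>

lemma mediated_card_le:
  assumes D: "pair_digraph D" and med: "mediated D" and ne: "pverts D \<noteq> {}"
  shows "card (pverts D) \<le> max_in_degree D ^ 2 + max_in_degree D + 1"
proof -
  interpret pair_digraph D by (fact D)
  define V where "V = pverts D"
  define d where "d = max_in_degree D"
  have V: "finite V" "V \<noteq> {}" using ne pair_finite_verts by (simp_all add: V_def)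
  have nb: "in_nbrs D z \<subseteq> V" for z
    using in_arcsD1 by (auto simp: in_nbrs_def V_def)
  have fin: "finite (closed_in_nbrs D z)" for z
    using finite_subset[OF nb V(1)] by (simp add: closed_in_nbrs_def)
  have "{(x, y) \<in> V \<times> V. x \<noteq> y} \<subseteq>
      (\<Union>z\<in>V. SIGMA x : closed_in_nbrs D z. closed_in_nbrs D z - {x})"
    using med by (fastforce simp: mediated_def V_def)
  then have "card {(x, y) \<in> V \<times> V. x \<noteq> y} \<le>
      card (\<Union>z\<in>V. SIGMA x : closed_in_nbrs D z. closed_in_nbrs D z - {x})"
    using V fin by (intro card_mono) auto
  also have "\<dots> \<le> (\<Sum>z\<in>V. card (SIGMA x : closed_in_nbrs D z. closed_in_nbrs D z - {x}))"
    using V by (intro card_UN_le) auto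
  also have "\<dots> \<le> (\<Sum>z\<in>V. (d + 1) * d)"
  proof (rule sum_mono)
    fix z assume "z \<in> V"
    have "card (closed_in_nbrs D z) \<le> d + 1"
      using card_insert_le_m1[of "d + 1" "in_nbrs D z" z]
        card_in_nbrs_le_max_in_degree[OF D, of z] \<open>z \<in> V\<close>
      by (simp add: closed_in_nbrs_def d_def V_def)
    then have "card (closed_in_nbrs D z) * (card (closed_in_nbrs D z) - 1) \<le> (d + 1) * d"
      by (intro mult_le_mono) auto
    then show "card (SIGMA x : closed_in_nbrs D z. closed_in_nbrs D z - {x}) \<le> (d + 1) * d"
      using fin[of z] by simp
  qed
  also have "{(x, y) \<in> V \<times> V. x \<noteq> y} = (SIGMA x : V. V - {x})" by auto
  finally have "card V * (card V - 1) \<le> card V * ((d + 1) * d)"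
    using V by simp
  moreover have "card V > 0" using V by (simp add: card_gt_0_iff)
  ultimately have "card V - 1 \<le> (d + 1) * d" by simp
  then show ?thesis by (simp add: V_def d_def power2_eq_square)
qed

text \<open>Since \<open>z \<in> B z\<close>, taking \<open>B z - {z}\<close> as in-neighbourhood of
  \<open>z\<close> makes \<open>B z\<close> the closed one, and block size \<open>Suc d\<close>
  becomes in-degree \<open>d\<close>.\<close>

lemma mediation_number_le_of_blocks:
  fixes B :: "'a \<Rightarrow> 'a set"
  assumes "finite V" "V \<noteq> {}"
    and B: "\<And>z. z \<in> V \<Longrightarrow> z \<in> B z \<and> B z \<subseteq> V \<and> card (B z) = Suc d"
    and cover: "\<And>x y. x \<in> V \<Longrightarrow> y \<in> V \<Longrightarrow> x \<noteq> y \<Longrightarrow> \<exists>z\<in>V. x \<in> B z \<and> y \<in> B z"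
  shows "mediation_number (card V) \<le> d"
proof -
  define D where "D = \<lparr>pverts = V, parcs = {(y, z). z \<in> V \<and> y \<in> B z \<and> y \<noteq> z}\<rparr>"
  have "parcs D \<subseteq> V \<times> V" using B by (auto simp: D_def)
  then have "finite (parcs D)" using \<open>finite V\<close> by (meson finite_SigmaI finite_subset)
  then have "pair_digraph D"
    by unfold_locales (use \<open>parcs D \<subseteq> V \<times> V\<close> \<open>finite V\<close> in \<open>auto simp: D_def\<close>)
  moreover have in_nbrs: "in_nbrs D z = B z - {z}" if "z \<in> V" for z
    using that by (auto simp: in_nbrs_def D_def)
  have "closed_in_nbrs D z = B z" if "z \<in> V" for z
    using that B by (auto simp: closed_in_nbrs_def in_nbrs)
  then have "mediated D"
    using cover unfolding mediated_def by (simp add: D_def)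
  ultimately have "mediation_number (card (pverts D)) \<le> max_in_degree D"
    by (rule mediation_number_le)
  also have "max_in_degree D = d"
  proof -
    have "card (in_nbrs D z) = d" if "z \<in> V" for z
      using that B by (simp add: in_nbrs)
    then have "(\<lambda>z. card (in_nbrs D z)) ` pverts D = {d}"
      using \<open>V \<noteq> {}\<close> by (auto simp: D_def)
    then show ?thesis by (simp add: max_in_degree_def)
  qed
  finally show ?thesis by (simp add: D_def)
qed

text \<open>For this argument the radicand is the square of \<open>2 q + 1\<close>, so the ceiling
  is taken of an integer.\<close>

lemma mediation_bound_plane: "mediation_bound (q^2 + q + 1) = int q"
proof -
  have "4 * real (q^2 + q + 1) - 3 = (2 * real q + 1)^2"
    by (simp add: power2_eq_square algebra_simps)
  then have "sqrt (4 * real (q^2 + q + 1) - 3) = 2 * real q + 1"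
    by simp
  then show ?thesis by (simp add: mediation_bound_def)
qed

section \<open>The projective plane over a finite field\<close>

context field
begin

text \<open>\<open>Inr (Some m)\<close> is the point at infinity of the lines of slope \<open>m\<close>, \<open>Inr None\<close> that of the vertical lines.\<close>

definition plane_points :: "('a \<times> 'a + 'a option) set" where
  "plane_points = (carrier R \<times> carrier R) <+> insert None (Some ` carrier R)"

definition affine_line :: "'a \<Rightarrow> 'a \<Rightarrow> ('a \<times> 'a + 'a option) set" where
  "affine_line m c = insert (Inr (Some m)) ((\<lambda>x. Inl (x, m \<otimes> x \<oplus> c)) ` carrier R)"

definition vertical_line :: "'a \<Rightarrow> ('a \<times> 'a + 'a option) set" where
  "vertical_line a = insert (Inr None) ((\<lambda>y. Inl (a, y)) ` carrier R)"

text \<open>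
  The affine points on the parabola \<open>b = a\<^sup>2\<close> are the ones that take the vertical lines. Another
  affine point \<open>(a, b)\<close> takes the line of slope \<open>a\<close> through it, whose intercept \<open>b - a\<^sup>2\<close> is
  nonzero; this leaves the lines through the origin for the points at infinity.
\<close>

fun assigned_line :: "'a \<times> 'a + 'a option \<Rightarrow> ('a \<times> 'a + 'a option) set" where
  "assigned_line (Inl (a, b)) =
     (if b = a \<otimes> a then vertical_line a else affine_line a (b \<ominus> a \<otimes> a))"
| "assigned_line (Inr (Some m)) = affine_line m \<zero>"
| "assigned_line (Inr None) = Inr ` insert None (Some ` carrier R)"

text \<open>Lets a line joining two points serve as the block of a vertex. For nonzero
  \<open>c\<close> the witness is the point of the line with abscissa \<open>m\<close>; it is off
  the parabola exactly because \<open>c\<close> is nonzero.\<close>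

lemma affine_line_assigned:
  assumes "m \<in> carrier R" "c \<in> carrier R"
  shows "\<exists>z\<in>plane_points. assigned_line z = affine_line m c"
proof (cases "c = \<zero>")
  case True
  then show ?thesis
    using assms by (intro bexI[of _ "Inr (Some m)"]) (auto simp: plane_points_def)
next
  case False
  have "m \<otimes> m \<oplus> c \<noteq> m \<otimes> m" "(m \<otimes> m \<oplus> c) \<ominus> m \<otimes> m = c"
    using assms False by (auto, algebra)
  then show ?thesis
    using assms by (intro bexI[of _ "Inl (m, m \<otimes> m \<oplus> c)"]) (auto simp: plane_points_def)
qed

lemma vertical_line_assigned:
  assumes "a \<in> carrier R"
  shows "\<exists>z\<in>plane_points. assigned_line z = vertical_line a"
  using assms by (intro bexI[of _ "Inl (a, a \<otimes> a)"]) (auto simp: plane_points_def)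

lemma assigned_line:
  assumes fin: "finite (carrier R)" and z: "z \<in> plane_points"
  shows "z \<in> assigned_line z \<and> assigned_line z \<subseteq> plane_points \<and>
         card (assigned_line z) = Suc (card (carrier R))"
proof -
  have aff: "affine_line m c \<subseteq> plane_points \<and> card (affine_line m c) = Suc (card (carrier R))"
    if "m \<in> carrier R" "c \<in> carrier R" for m c
    using that fin by (auto simp: affine_line_def plane_points_def card_image inj_on_def card_insert_if)
  have ver: "vertical_line a \<subseteq> plane_points \<and> card (vertical_line a) = Suc (card (carrier R))"
    if "a \<in> carrier R" for a
    using that fin by (auto simp: vertical_line_def plane_points_def card_image inj_on_def card_insert_if)
  from z consider (aff) a b where "z = Inl (a, b)" "a \<in> carrier R" "b \<in> carrier R"
    | (slope) m where "z = Inr (Some m)" "m \<in> carrier R" | (inf) "z = Inr None"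
    by (auto simp: plane_points_def)
  then show ?thesis
  proof cases
    case aff': aff
    have "b = a \<otimes> a \<oplus> (b \<ominus> a \<otimes> a)"
      using aff' by algebra
    then have "z \<in> assigned_line z"
      using aff' by (auto simp: vertical_line_def affine_line_def)
    then show ?thesis
      using aff' aff ver by simp
  next
    case slope
    then show ?thesis using aff[of m \<zero>] by (simp add: affine_line_def)
  next
    case inf
    then show ?thesis using fin
      by (auto simp: plane_points_def card_image card_insert_if)
  qed
qed

lemma plane_points_joined:
  assumes x: "x \<in> plane_points" and y: "y \<in> plane_points"
  shows "\<exists>z\<in>plane_points. x \<in> assigned_line z \<and> y \<in> assigned_line z"
proof -
  have affI: ?thesis if "m \<in> carrier R" "c \<in> carrier R" "x \<in> affine_line m c" "y \<in> affine_line m c" for m c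
    using affine_line_assigned[of m c] that by force
  have verI: ?thesis if "a \<in> carrier R" "x \<in> vertical_line a" "y \<in> vertical_line a" for a
    using vertical_line_assigned[of a] that by force
  \<comment> \<open>The joining line is vertical, or has the prescribed slope \<open>m\<close>,
    which forces the intercept \<open>b \<ominus> m \<otimes> a\<close>.\<close>
  have mixed: "\<exists>z\<in>plane_points. Inl (a, b) \<in> assigned_line z \<and> Inr v \<in> assigned_line z"
    if ab: "a \<in> carrier R" "b \<in> carrier R" and v: "Inr v \<in> plane_points" for a b v
  proof (cases v)
    case None
    from vertical_line_assigned[OF ab(1)]
    obtain z where "z \<in> plane_points" "assigned_line z = vertical_line a" by blast
    with None ab show ?thesis
      by (intro bexI[of _ z]) (auto simp: vertical_line_def)
  next
    case (Some m)
    then have m: "m \<in> carrier R" using v by (auto simp: plane_points_def)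
    have "b = m \<otimes> a \<oplus> (b \<ominus> m \<otimes> a)" using ab m by algebra
    moreover have "b \<ominus> m \<otimes> a \<in> carrier R" using ab m by simp
    with affine_line_assigned[OF m]
    obtain z where "z \<in> plane_points" "assigned_line z = affine_line m (b \<ominus> m \<otimes> a)" by blast
    ultimately show ?thesis
      using Some ab m by (intro bexI[of _ z]) (auto simp: affine_line_def)
  qed
  consider (II) u v where "x = Inr u" "y = Inr v"
    | (AI) a b v where "x = Inl (a, b)" "y = Inr v"
    | (IA) a b u where "x = Inr u" "y = Inl (a, b)"
    | (AA) a b a' b' where "x = Inl (a, b)" "y = Inl (a', b')"
    by (metis old.sum.exhaust prod.exhaust)
  then show ?thesis
  proof cases
    case II
    \<comment> \<open>The line at infinity is the one assigned to \<open>Inr None\<close>.\<close>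
    then show ?thesis
      using x y by (intro bexI[of _ "Inr None"]) (auto simp: plane_points_def)
  next
    case AI
    then show ?thesis
      using x y mixed[of a b v] by (auto simp: plane_points_def)
  next
    case IA
    then show ?thesis
      using x y mixed[of a b u] by (auto simp: plane_points_def)
  next
    case AA
    then have carr: "a \<in> carrier R" "b \<in> carrier R" "a' \<in> carrier R" "b' \<in> carrier R"
      using x y by (auto simp: plane_points_def)
    show ?thesis
    proof (cases "a = a'")
      case True
      then show ?thesis
        using carr AA by (intro verI[of a]) (auto simp: vertical_line_def)
    next
      case False
      then have unit: "a' \<ominus> a \<in> Units R"
        using carr r_right_minus_eq[of a' a] by (auto simp: field_Units)
      \<comment> \<open>\<open>i\<close> inverts the nonzero difference of abscissae;
        \<open>m\<close> is the slope through the two points and \<open>c\<close> the intercept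
        fitting the first.\<close>
      define i where "i = inv (a' \<ominus> a)"
      have i: "i \<in> carrier R" "i \<otimes> (a' \<ominus> a) = \<one>"
        using unit by (simp_all add: i_def)
      define m where "m = (b' \<ominus> b) \<otimes> i"
      define c where "c = b \<ominus> m \<otimes> a"
      have m: "m \<in> carrier R" "c \<in> carrier R"
        using carr i by (simp_all add: m_def c_def)
      have "b = m \<otimes> a \<oplus> c"
        using carr m(1) unfolding c_def by algebra
      moreover have "m \<otimes> (a' \<ominus> a) = b' \<ominus> b"
        using carr i by (simp add: m_def m_assoc)
      then have "b' = m \<otimes> a' \<oplus> c"
        using carr m(1) unfolding c_def by algebra
      ultimately show ?thesis
        using AA m carr by (intro affI[of m c]) (auto simp: affine_line_def)
    qed
  qed
qed

text \<open>Over a field of size \<open>q\<close> there are \<open>q^2\<close> affine points and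
  \<open>q + 1\<close> at infinity; lines of \<open>q + 1\<close> points give in-degree
  \<open>q\<close>.\<close>

lemma mediation_number_plane_le:
  assumes "finite (carrier R)"
  shows "mediation_number (card (carrier R) ^ 2 + card (carrier R) + 1) \<le> card (carrier R)"
proof -
  have fin: "finite plane_points" using assms by (simp add: plane_points_def)
  have card: "card plane_points = card (carrier R) ^ 2 + card (carrier R) + 1"
    using assms by (simp add: plane_points_def card_Plus card_cartesian_product card_insert_if
        card_image power2_eq_square image_iff)
  have "plane_points \<noteq> {}" by (auto simp: plane_points_def)
  then have "mediation_number (card plane_points) \<le> card (carrier R)"
    by (rule mediation_number_le_of_blocks[OF fin _ assigned_line[OF assms]])
       (simp_all add: plane_points_joined)
  then show ?thesis by (simp add: card)
qed

end

theorem corollary4p5: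
  fixes q :: nat
  assumes "primepow q"
  shows "int (mediation_number (q^2 + q + 1)) = mediation_bound (q^2 + q + 1)
       \<and> mediation_bound (q^2 + q + 1) = int q"
proof -
  let ?\<mu> = "mediation_number (q^2 + q + 1)"
  obtain F :: "(((int list \<times> nat) multiset) \<Rightarrow> int) ring" where F: "field F" "card (carrier F) = q"
    using finite_field_exists[OF assms] by blast
  have "q > 0" using primepow_gt_0_nat[OF assms] .
  \<comment> \<open>Infinite sets have \<open>card\<close> 0, so a positive value forces
    finiteness.\<close>
  then have "finite (carrier F)" using F(2) by (metis card.infinite less_irrefl)
  then have "?\<mu> \<le> q"
    using field.mediation_number_plane_le[OF F(1)] F(2) by simp
  moreover have "q \<le> ?\<mu>"
  proof -
    obtain D :: "nat pair_pre_digraph" where D: "pair_digraph D" "card (pverts D) = q^2 + q + 1"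
      "mediated D" "max_in_degree D = ?\<mu>"
      using mediation_number_attained by blast
    from D(2) have "pverts D \<noteq> {}" by auto
    \<comment> \<open>The counting bound is compared through \<open>t * (t + 1)\<close>, which is
      strictly increasing in \<open>t\<close>.\<close>
    with mediated_card_le[OF D(1,3)] D(2,4) have "q * (q + 1) \<le> ?\<mu> * (?\<mu> + 1)"
      by (simp add: power2_eq_square)
    moreover have "?\<mu> * (?\<mu> + 1) < q * (q + 1)" if "?\<mu> < q"
      using that by (intro mult_strict_mono) auto
    ultimately show ?thesis by (meson not_le)
  qed
  ultimately show ?thesis unfolding mediation_bound_plane by simp
qed

end
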